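(* Let $\mu :\mathbb{N} \to \mathbb{R}^+$ be a scaling function. The equality $\underline{p}_{\mu}(\mathbb{N}) =1$ holds if and only if $\mu(\mathbb{N}) \in \mathbf{SSP}$.
   Context: $\mathbb{R}^+=[0,\infty)$. A scaling function is a strictly decreasing function $\mu:\mathbb{N}\to\mathbb{R}^+$ with $\lim_{n\to\infty}\mu(n)=0$. For $E\subseteq\mathbb{N}$ and $n\in\mathbb{N}$, $$\lambda_\mu(E,n)=\sup\{|\mu(n^{(1)})-\mu(n^{(2)})| : n\le n^{(1)}<n^{(2)},\ n^{(1)},n^{(2)}\in\mathbb{N},\ (n^{(1)},n^{(2)})\cap E=\emptyset\},$$ and the lower porosity of $E$ at infinity is $\underline{p}_\mu(E)=\liminf_{n\to\infty}\lambda_\mu(E,n)/\mu(n)$. For $T\subseteq\mathbb{R}^+$, $acT$ denotes the set of accumulation points of $T$ and $ExtT$ the exterior of $T$. A set $T\subseteq\mathbb{R}^+$ belongs to the family $\mathbf{SSP}$ if $0\notin acT$ or there is a sequence $\{(a_k,b_k)\}_{k\in\mathbb{N}}$ of open intervals $(a_k,b_k)\subseteq\mathbb{R}^+$ meeting the following conditions: (1) $a_k\ge b_{k+1}>a_{k+1}>0$ for each $k\in\mathbb{N}$; (2) every interval $(a_k,b_k)$ is a connected component of $ExtT$, i.e. $(a_k,b_k)\cap T=\emptyset$, but for every open interval $(a,b)\supseteq(a_k,b_k)$ with $(a,b)\ne(a_k,b_k)$ we have $(a,b)\cap T\neq\emptyset$; (3) $\lim_{k\to\infty}a_k=0$, $\lim_{k\to\infty}\frac{b_k-a_k}{b_k}=1$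 and $\lim_{k\to\infty}\frac{b_{k+1}}{a_k}=1$. *)

theory Defs
  imports "HOL-Analysis.Analysis"
begin

definition scaling_function :: "(nat \<Rightarrow> real) \<Rightarrow> bool" where
  "scaling_function \<mu> \<longleftrightarrow>
     (\<forall>n. 0 \<le> \<mu> n) \<and> strict_antimono_on UNIV \<mu> \<and> \<mu> \<longlonglongrightarrow> 0"

text \<open>The interval \<open>{n1<..<n2}\<close> is the open interval of natural numbers; for \<open>n2 = Suc n1\<close>
  it is empty.\<close>

definition gap_sup :: "(nat \<Rightarrow> real) \<Rightarrow> nat set \<Rightarrow> nat \<Rightarrow> real" where
  "gap_sup \<mu> E n =
     Sup {\<bar>\<mu> n1 - \<mu> n2\<bar> | n1 n2. n \<le> n1 \<and> n1 < n2 \<and> {n1<..<n2} \<inter> E = {}}"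

text \<open>The supremum above is taken in the reals, where it is only meaningful for nonempty sets that
  are bounded above; this is always the case for scaling functions.\<close>

lemma gap_sup_nonempty:
  fixes \<mu> :: "nat \<Rightarrow> real"
  shows "{\<bar>\<mu> n1 - \<mu> n2\<bar> | n1 n2. n \<le> n1 \<and> n1 < n2 \<and> {n1<..<n2} \<inter> E = {}} \<noteq> {}"
proof -
  have "n \<le> n \<and> n < Suc n \<and> {n<..<Suc n} \<inter> E = {}" by auto
  then show ?thesis by blast
qed

lemma gap_sup_bdd_above:
  assumes "scaling_function \<mu>"
  shows "bdd_above {\<bar>\<mu> n1 - \<mu> n2\<bar> | n1 n2. n \<le> n1 \<and> n1 < n2 \<and> {n1<..<n2} \<inter> E = {}}"
proof -
  have nn: "0 \<le> \<mu> k" for k using assms by (simp add: scaling_function_def)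
  have dec: "\<mu> j < \<mu> i" if "i < j" for i j
    using assms that by (auto simp: scaling_function_def monotone_on_def)
  have "\<bar>\<mu> n1 - \<mu> n2\<bar> \<le> \<mu> n" if "n \<le> n1" "n1 < n2" for n1 n2
    using nn[of n2] dec[of n1 n2] dec[of n n1] that by (cases "n = n1") auto
  then show ?thesis by (intro bdd_aboveI[of _ "\<mu> n"]) auto
qed

text \<open>The limit inferior is formed in the extended reals, so that it exists unconditionally.\<close>

definition lower_porosity :: "(nat \<Rightarrow> real) \<Rightarrow> nat set \<Rightarrow> ereal" where
  "lower_porosity \<mu> E = liminf (\<lambda>n. ereal (gap_sup \<mu> E n / \<mu> n))"

definition Ext :: "real set \<Rightarrow> real set" where
  "Ext T = interior (- T)"

definition SSP :: "real set set" where
  "SSP = {T. T \<subseteq> {0..} \<and>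
     (\<not> 0 islimpt T \<or>
      (\<exists>a b :: nat \<Rightarrow> real.
         (\<forall>k. a k < b k \<and> {a k<..<b k} \<subseteq> {0..}) \<and>
         (\<forall>k. a k \<ge> b (Suc k) \<and> b (Suc k) > a (Suc k) \<and> a (Suc k) > 0) \<and>
         (\<forall>k. {a k<..<b k} \<in> components (Ext T)) \<and>
         a \<longlonglongrightarrow> 0 \<and>
         (\<lambda>k. (b k - a k) / b k) \<longlonglongrightarrow> 1 \<and>
         (\<lambda>k. b (Suc k) / a k) \<longlonglongrightarrow> 1))}"

text \<open>An open interval is a connected component of the exterior of \<open>T\<close> iff it misses \<open>T\<close> while
  every strictly larger open interval meets \<open>T\<close>.\<close>

lemma interval_component_Ext_iff:
  fixes a b :: real
  assumes "a < b"
  shows "{a<..<b} \<in> components (Ext T) \<longleftrightarrow>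
    {a<..<b} \<inter> T = {} \<and>
    (\<forall>c d. {a<..<b} \<subseteq> {c<..<d} \<and> {c<..<d} \<noteq> {a<..<b} \<longrightarrow> {c<..<d} \<inter> T \<noteq> {})"
    (is "?L \<longleftrightarrow> ?R")
proof
  assume L: ?L
  have "{a<..<b} \<inter> T = {}"
    using in_components_subset[OF L] interior_subset[of "- T"] unfolding Ext_def by blast
  moreover have "{c<..<d} \<inter> T \<noteq> {}"
    if "{a<..<b} \<subseteq> {c<..<d}" "{c<..<d} \<noteq> {a<..<b}" for c d
  proof
    assume "{c<..<d} \<inter> T = {}"
    then have "{c<..<d} \<subseteq> Ext T"
      unfolding Ext_def by (intro interior_maximal) auto
    moreover have "{a<..<b} \<inter> {c<..<d} \<noteq> {}"
      using that(1) in_components_nonempty[OF L] by blast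
    ultimately have "{c<..<d} \<subseteq> {a<..<b}"
      using components_maximal[OF L, of "{c<..<d}"] by simp
    then show False using that by blast
  qed
  ultimately show ?R by blast
next
  assume R: ?R
  define m where "m = (a + b) / 2"
  have m: "a < m" "m < b" using assms by (auto simp: m_def)
  have sub: "{a<..<b} \<subseteq> Ext T"
    unfolding Ext_def using R by (intro interior_maximal) auto
  have max: "D = {a<..<b}" if D: "D \<subseteq> Ext T" "connected D" "{a<..<b} \<subseteq> D" for D
  proof (rule ccontr)
    assume "D \<noteq> {a<..<b}"
    then obtain x where x: "x \<in> D" "x \<notin> {a<..<b}" using D(3) by blast
    have ivl: "is_interval D" using D(2) by (simp add: is_interval_connected_1)
    have mD: "m \<in> D" using m D(3) by auto
    have "open (Ext T)" by (simp add: Ext_def)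
    then obtain e where e: "e > 0" "ball x e \<subseteq> Ext T"
      using x(1) D(1) openE by blast
    have miss: "y \<notin> T" if "y \<in> D \<or> y \<in> ball x e" for y
      using that D(1) e(2) interior_subset[of "- T"] unfolding Ext_def by blast
    show False
    proof (cases "x \<ge> b")
      case True
      have "y \<notin> T" if "y \<in> {a<..<x + e}" for y
      proof (cases "y < b \<or> y > x")
        case True
        then show ?thesis using that R miss[of y] by (auto simp: dist_real_def)
      next
        case False
        then have "y \<in> D"
          using m \<open>x \<ge> b\<close> mD x(1) mem_is_interval_1_I[OF ivl, of m x y] by auto
        then show ?thesis using miss by blast
      qed
      moreover have "{a<..<b} \<subseteq> {a<..<x + e}" "{a<..<x + e} \<noteq> {a<..<b}"
        using True e(1) assms by (auto simp: set_eq_iff intro!: exI[of _ b])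
      ultimately show False using R by blast
    next
      case False
      then have xa: "x \<le> a" using x(2) by auto
      have "y \<notin> T" if "y \<in> {x - e<..<b}" for y
      proof (cases "y > a \<or> y < x")
        case True
        then show ?thesis using that R miss[of y] by (auto simp: dist_real_def)
      next
        case False
        then have "y \<in> D"
          using m xa mD x(1) mem_is_interval_1_I[OF ivl, of x m y] by auto
        then show ?thesis using miss by blast
      qed
      moreover have "{a<..<b} \<subseteq> {x - e<..<b}" "{x - e<..<b} \<noteq> {a<..<b}"
        using xa e(1) assms by (auto simp: set_eq_iff intro!: exI[of _ a])
      ultimately show False using R by blast
    qed
  qed
  show ?L
    unfolding in_components_maximal
    using assms sub max by auto
qed

end

theory Submission
  imports Defs
begin

text \<open>For \<open>E = \<nat>\<close> only consecutive indices are admissible, so \<open>gap_sup \<mu> UNIV n\<close> is the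
  supremum of the gaps \<open>\<mu> j - \<mu> (Suc j)\<close> with \<open>j \<ge> n\<close>. It is at most \<open>\<mu> n\<close>, hence the lower
  porosity is 1 iff \<open>gap_sup \<mu> UNIV n / \<mu> n\<close> tends to 1.

  Given this limit, the intervals are chosen greedily: starting from an index \<open>m\<close>, pick an almost
  largest gap \<open>(\<mu> (Suc j), \<mu> j)\<close> with \<open>j \<ge> m\<close> and restart at \<open>Suc j\<close>. As \<open>\<mu> j \<le> \<mu> m\<close> and the gap
  is comparable to \<open>\<mu> m\<close>, so is \<open>\<mu> j\<close>, which gives both ratio conditions.

  Conversely, if \<open>b (Suc k)\<close> is the largest right end point not above \<open>\<mu> n\<close>, then
  \<open>\<mu> n \<le> a k\<close>, because \<open>\<mu> n\<close> cannot lie in \<open>(a k, b k)\<close>, and the gap around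
  \<open>(a (Suc k), b (Suc k))\<close> has length at least
  \<open>b (Suc k) - a (Suc k) \<sim> b (Suc k) \<sim> a k \<ge> \<mu> n\<close>.\<close>

lemma scaling_function_less_iff:
  assumes "scaling_function \<mu>"
  shows "\<mu> i < \<mu> j \<longleftrightarrow> j < i"
  using assms unfolding scaling_function_def monotone_on_def
  by (metis UNIV_I less_asym linorder_cases order_less_irrefl)

lemma scaling_function_le_iff:
  assumes "scaling_function \<mu>"
  shows "\<mu> i \<le> \<mu> j \<longleftrightarrow> j \<le> i"
  using scaling_function_less_iff[OF assms, of j i] by linarith

lemma scaling_function_pos:
  assumes "scaling_function \<mu>"
  shows "0 < \<mu> n"
proof -
  have "0 \<le> \<mu> (Suc n)" using assms by (simp add: scaling_function_def)
  then show ?thesis using scaling_function_less_iff[OF assms, of "Suc n" n] by simp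
qed

lemma scaling_function_tendsto:
  assumes "scaling_function \<mu>"
  shows "\<mu> \<longlonglongrightarrow> 0"
  using assms by (simp add: scaling_function_def)

lemma gap_le_gap_sup_UNIV:
  assumes "scaling_function \<mu>" "n \<le> j"
  shows "\<mu> j - \<mu> (Suc j) \<le> gap_sup \<mu> UNIV n"
proof -
  have "{j<..<Suc j} \<inter> UNIV = {}" by auto
  then have "\<bar>\<mu> j - \<mu> (Suc j)\<bar> \<le> gap_sup \<mu> UNIV n"
    unfolding gap_sup_def using assms(2)
    by (intro cSup_upper gap_sup_bdd_above[OF assms(1)]) blast
  then show ?thesis by linarith
qed

text \<open>A pair \<open>i < k\<close> with no index strictly between must be consecutive, since
  \<open>Suc i\<close> would otherwise lie in \<open>{i<..<k}\<close>.\<close>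

lemma less_gap_sup_UNIV_obtains:
  assumes "scaling_function \<mu>" "x < gap_sup \<mu> UNIV n"
  obtains j where "n \<le> j" "x < \<mu> j - \<mu> (Suc j)"
proof -
  obtain i k where ik: "n \<le> i" "i < k" "{i<..<k} \<inter> UNIV = {}" "x < \<bar>\<mu> i - \<mu> k\<bar>"
    using assms(2) less_cSup_iff[OF gap_sup_nonempty gap_sup_bdd_above[OF assms(1)]]
    unfolding gap_sup_def by blast
  then have "Suc i \<notin> {i<..<k}" by blast
  with ik(2) have "k = Suc i" by simp
  moreover have "\<mu> (Suc i) < \<mu> i" using scaling_function_less_iff[OF assms(1)] by simp
  ultimately show ?thesis using that ik by simp
qed

lemma gap_sup_UNIV_le:
  assumes "scaling_function \<mu>"
  shows "gap_sup \<mu> UNIV n \<le> \<mu> n"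
proof (rule ccontr)
  assume "\<not> ?thesis"
  then obtain j where j: "n \<le> j" "\<mu> n < \<mu> j - \<mu> (Suc j)"
    using less_gap_sup_UNIV_obtains[OF assms, of "\<mu> n" n] by auto
  moreover have "\<mu> j \<le> \<mu> n" using scaling_function_le_iff[OF assms] j(1) by simp
  ultimately show False using scaling_function_pos[OF assms, of "Suc j"] by linarith
qed

lemma lower_porosity_UNIV_eq_1_iff:
  assumes "scaling_function \<mu>"
  shows "lower_porosity \<mu> UNIV = 1 \<longleftrightarrow> (\<lambda>n. gap_sup \<mu> UNIV n / \<mu> n) \<longlonglongrightarrow> 1"
proof -
  define r where "r n = gap_sup \<mu> UNIV n / \<mu> n" for n
  have "r n \<le> 1" for n
    unfolding r_def using gap_sup_UNIV_le[OF assms] scaling_function_pos[OF assms]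
    by (simp add: divide_le_eq_1)
  then have "limsup (\<lambda>n. ereal (r n)) \<le> 1"
    by (intro Limsup_bounded) (simp add: always_eventually)
  then have "liminf (\<lambda>n. ereal (r n)) = 1 \<longleftrightarrow> (\<lambda>n. ereal (r n)) \<longlonglongrightarrow> 1"
    using Liminf_le_Limsup[of sequentially "\<lambda>n. ereal (r n)"]
    by (auto simp: tendsto_iff_Liminf_eq_Limsup)
  also have "\<dots> \<longleftrightarrow> r \<longlonglongrightarrow> 1"
    unfolding one_ereal_def by simp
  finally show ?thesis unfolding lower_porosity_def r_def .
qed

text \<open>Excludes the first alternative of \<open>SSP\<close>, so that membership of
  \<open>range \<mu>\<close> always provides a sequence of intervals.\<close>

lemma islimpt_range_scaling_function:
  assumes "scaling_function \<mu>"
  shows "0 islimpt range \<mu>"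
  unfolding islimpt_sequential
proof (intro exI conjI allI)
  show "\<mu> n \<in> range \<mu> - {0}" for n using scaling_function_pos[OF assms, of n] by simp
  show "\<mu> \<longlonglongrightarrow> 0" by (rule scaling_function_tendsto[OF assms])
qed

text \<open>A strictly larger open interval contains one of the two end points, and both are values
  of \<open>\<mu>\<close>.\<close>

lemma gap_in_components_Ext:
  assumes "scaling_function \<mu>"
  shows "{\<mu> (Suc j)<..<\<mu> j} \<in> components (Ext (range \<mu>))"
proof -
  have lt: "\<mu> (Suc j) < \<mu> j" using scaling_function_less_iff[OF assms] by simp
  have "{\<mu> (Suc j)<..<\<mu> j} \<inter> range \<mu> = {}"
    by (auto simp: scaling_function_less_iff[OF assms])
  moreover have "{c<..<d} \<inter> range \<mu> \<noteq> {}"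
    if "{\<mu> (Suc j)<..<\<mu> j} \<subseteq> {c<..<d}" "{c<..<d} \<noteq> {\<mu> (Suc j)<..<\<mu> j}" for c d
  proof -
    have "c \<le> \<mu> (Suc j)" "\<mu> j \<le> d"
      using that(1) lt by (simp_all add: greaterThanLessThan_subseteq_greaterThanLessThan)
    then have "\<mu> (Suc j) \<in> {c<..<d} \<or> \<mu> j \<in> {c<..<d}"
      using that(2) lt by force
    then show ?thesis by blast
  qed
  ultimately show ?thesis
    unfolding interval_component_Ext_iff[OF lt] by (intro conjI allI impI) auto
qed

lemma porous_imp_SSP:
  assumes s: "scaling_function \<mu>"
    and lim: "(\<lambda>n. gap_sup \<mu> UNIV n / \<mu> n) \<longlonglongrightarrow> 1"
  shows "range \<mu> \<in> SSP"
proof -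
  note pos = scaling_function_pos[OF s]
  \<comment> \<open>The tolerance is positive, so some gap exceeds the reduced supremum; relative to
    \<open>\<mu> n\<close> it is only \<open>inverse (Suc n)\<close>, which vanishes in the
    limit.\<close>
  have "\<exists>j\<ge>n. gap_sup \<mu> UNIV n - \<mu> n * inverse (Suc n) < \<mu> j - \<mu> (Suc j)" for n
    by (rule less_gap_sup_UNIV_obtains[OF s,
          of "gap_sup \<mu> UNIV n - \<mu> n * inverse (Suc n)" n])
      (use pos[of n] in auto)
  then obtain J where J_ge: "\<And>n. n \<le> J n"
    and J_gap: "\<And>n. gap_sup \<mu> UNIV n - \<mu> n * inverse (Suc n) < \<mu> (J n) - \<mu> (Suc (J n))"
    by metis
  define m where "m = rec_nat 0 (\<lambda>_ n. Suc (J n))"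
  have m_Suc: "m (Suc k) = Suc (J (m k))" for k by (simp add: m_def)
  have "m k < m (Suc k)" for k using J_ge[of "m k"] by (simp add: m_Suc)
  then have m_top: "filterlim m at_top sequentially"
    by (intro filterlim_subseq strict_monoI_Suc)
  have J_le: "\<mu> (J n) \<le> \<mu> n" for n
    using J_ge scaling_function_le_iff[OF s] by simp
  have J_lt: "\<mu> (Suc (J n)) < \<mu> (J n)" for n
    using scaling_function_less_iff[OF s] by simp
  \<comment> \<open>A lower bound for the chosen gap relative to \<open>\<mu> n\<close>. Both ratios
    are squeezed between \<open>low\<close> along \<open>m\<close> and 1.\<close>
  define low where "low n = gap_sup \<mu> UNIV n / \<mu> n - inverse (Suc n)" for n
  have low: "low n \<le> (\<mu> (J n) - \<mu> (Suc (J n))) / \<mu> n" for n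
  proof -
    have "low n = (gap_sup \<mu> UNIV n - \<mu> n * inverse (Suc n)) / \<mu> n"
      using pos[of n] unfolding low_def by (simp add: diff_divide_distrib)
    also have "\<dots> \<le> (\<mu> (J n) - \<mu> (Suc (J n))) / \<mu> n"
      using J_gap[of n] pos[of n] by (intro divide_right_mono) auto
    finally show ?thesis .
  qed
  have "low \<longlonglongrightarrow> 1"
    unfolding low_def using tendsto_diff[OF lim LIMSEQ_inverse_real_of_nat] by simp
  then have low_m: "(\<lambda>k. low (m k)) \<longlonglongrightarrow> 1" using m_top by (rule filterlim_compose)
  define a where "a k = \<mu> (Suc (J (m k)))" for k
  define b where "b k = \<mu> (J (m k))" for k
  \<comment> \<open>The left end of each interval is also the value at the next restart index, so
    \<open>b (Suc k) / a k\<close> compares the next right end with the value from which its search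
    started.\<close>
  have a_eq: "a k = \<mu> (m (Suc k))" for k by (simp add: a_def m_Suc)
  have ab: "0 < a k" "a k < b k" "b (Suc k) \<le> a k" for k
    using pos J_lt J_le by (simp_all add: a_def b_def m_Suc)
  have "(\<lambda>k. \<mu> (m k)) \<longlonglongrightarrow> 0"
    using scaling_function_tendsto[OF s] m_top by (rule filterlim_compose)
  then have a0: "a \<longlonglongrightarrow> 0" unfolding a_eq[abs_def] by (rule LIMSEQ_Suc)
  have length_ratio: "(\<lambda>k. (b k - a k) / b k) \<longlonglongrightarrow> 1"
  proof (rule tendsto_sandwich[OF _ _ low_m tendsto_const])
    have "low (m k) \<le> (b k - a k) / b k" for k
    proof -
      have "low (m k) \<le> (b k - a k) / \<mu> (m k)" using low by (simp add: a_def b_def)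
      also have "\<dots> \<le> (b k - a k) / b k"
        using ab[of k] J_le[of "m k"] pos by (intro divide_left_mono) (auto simp: b_def)
      finally show ?thesis .
    qed
    then show "\<forall>\<^sub>F k in sequentially. low (m k) \<le> (b k - a k) / b k" by simp
    have "(b k - a k) / b k \<le> 1" for k using ab[of k] by (simp add: divide_le_eq_1)
    then show "\<forall>\<^sub>F k in sequentially. (b k - a k) / b k \<le> 1" by simp
  qed
  have end_ratio: "(\<lambda>k. b (Suc k) / a k) \<longlonglongrightarrow> 1"
  proof (rule tendsto_sandwich[OF _ _ LIMSEQ_Suc[OF low_m] tendsto_const])
    have "low (m (Suc k)) \<le> b (Suc k) / a k" for k
    proof -
      have "low (m (Suc k)) \<le> (b (Suc k) - a (Suc k)) / a k"
        using low[of "m (Suc k)"] by (simp add: a_eq[of k] a_def[of "Suc k"] b_def)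
      also have "\<dots> \<le> b (Suc k) / a k"
        using ab(1)[of k] ab(1)[of "Suc k"] by (intro divide_right_mono) auto
      finally show ?thesis .
    qed
    then show "\<forall>\<^sub>F k in sequentially. low (m (Suc k)) \<le> b (Suc k) / a k" by simp
    have "b (Suc k) / a k \<le> 1" for k using ab(1,3)[of k] by (simp add: divide_le_eq_1)
    then show "\<forall>\<^sub>F k in sequentially. b (Suc k) / a k \<le> 1" by simp
  qed
  have comp: "{a k<..<b k} \<in> components (Ext (range \<mu>))" for k
    unfolding a_def b_def by (rule gap_in_components_Ext[OF s])
  have nonneg: "{a k<..<b k} \<subseteq> {0..}" for k using ab(1)[of k] by auto
  have "range \<mu> \<subseteq> {0..}" using pos less_imp_le by auto
  with ab nonneg comp a0 length_ratio end_ratio show ?thesis unfolding SSP_def by blast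
qed

lemma SSP_imp_porous:
  assumes s: "scaling_function \<mu>"
    and "range \<mu> \<in> SSP"
  shows "(\<lambda>n. gap_sup \<mu> UNIV n / \<mu> n) \<longlonglongrightarrow> 1"
proof -
  note pos = scaling_function_pos[OF s]
  note mu0 = scaling_function_tendsto[OF s]
  obtain a b :: "nat \<Rightarrow> real" where ab: "\<And>k. a k < b k"
    and ba: "\<And>k. b (Suc k) \<le> a k" and a_pos: "\<And>k. 0 < a (Suc k)"
    and comp: "\<And>k. {a k<..<b k} \<in> components (Ext (range \<mu>))"
    and a0: "a \<longlonglongrightarrow> 0"
    and length_ratio: "(\<lambda>k. (b k - a k) / b k) \<longlonglongrightarrow> 1"
    and end_ratio: "(\<lambda>k. b (Suc k) / a k) \<longlonglongrightarrow> 1"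
    using assms(2) islimpt_range_scaling_function[OF s] unfolding SSP_def by blast
  \<comment> \<open>Positivity is given at successor indices; at 0 it follows from
    \<open>b 1 \<le> a 0 < b 0\<close>.\<close>
  have b_pos: "0 < b k" for k
  proof -
    have "0 < b (Suc k)" using a_pos[of k] ab[of "Suc k"] by linarith
    then show ?thesis using ba[of k] ab[of k] by linarith
  qed
  have "b (Suc k) \<le> b k" for k using ab[of k] ba[of k] by linarith
  then have b_anti: "b l \<le> b k" if "k \<le> l" for k l using that by (rule lift_Suc_antimono_le)
  have miss: "\<mu> i \<le> a k" if "\<mu> i < b k" for i k
  proof -
    have "{a k<..<b k} \<inter> range \<mu> = {}"
      using comp[of k] unfolding interval_component_Ext_iff[OF ab[of k]] by (rule conjunct1)
    then have "\<mu> i \<notin> {a k<..<b k}" by blast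
    with that show ?thesis by simp
  qed
  \<comment> \<open>Cancelling \<open>b (Suc k)\<close> leaves
    \<open>(b (Suc k) - a (Suc k)) / a k\<close>; the factored form exhibits the limit as a product
    of the two given ones.\<close>
  define q where "q k = (b (Suc k) - a (Suc k)) / b (Suc k) * (b (Suc k) / a k)" for k
  have "q \<longlonglongrightarrow> 1"
    unfolding q_def using tendsto_mult[OF LIMSEQ_Suc[OF length_ratio] end_ratio] by simp
  have key: "\<exists>k\<ge>K. q k \<le> gap_sup \<mu> UNIV n / \<mu> n" if n: "\<mu> n < b K" for n K
  proof -
    obtain l where l: "a l < \<mu> n"
      using order_tendstoD(2)[OF a0 pos[of n]] eventually_happens by fastforce
    then have "b (Suc l) \<le> \<mu> n" using ba[of l] by linarith
    then have ex: "\<exists>k. b k \<le> \<mu> n" by blast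
    define k' where "k' = (LEAST k. b k \<le> \<mu> n)"
    have k': "b k' \<le> \<mu> n" unfolding k'_def using ex by (rule LeastI_ex)
    \<comment> \<open>As \<open>b\<close> is antitone, \<open>k' \<le> K\<close> would give
      \<open>b K \<le> b k' \<le> \<mu> n\<close>. In particular \<open>k'\<close> is a
      successor.\<close>
    have "K < k'" using b_anti[of k' K] k' n by (meson leI le_less_trans less_irrefl)
    then obtain k where k: "k' = Suc k" "K \<le> k" by (cases k') auto
    have "\<not> b k \<le> \<mu> n" using not_less_Least[of k "\<lambda>k. b k \<le> \<mu> n"] k by (simp add: k'_def)
    then have le: "\<mu> n \<le> a k" by (intro miss) simp
    \<comment> \<open>The last index whose value is not below \<open>b (Suc k)\<close>, found as the
      predecessor of the first index whose value is below it.\<close>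
    obtain j where j: "n \<le> j" "b (Suc k) \<le> \<mu> j" "\<mu> (Suc j) < b (Suc k)"
    proof -
      obtain i where i: "\<mu> i < b (Suc k)"
        using order_tendstoD(2)[OF mu0 b_pos[of "Suc k"]] eventually_happens by fastforce
      define i' where "i' = (LEAST i. \<mu> i < b (Suc k))"
      have i': "\<mu> i' < b (Suc k)" unfolding i'_def using i by (rule LeastI)
      then have "n < i'"
        using k' scaling_function_less_iff[OF s, of i' n] unfolding k by linarith
      then obtain j where j: "i' = Suc j" "n \<le> j" by (cases i') auto
      have "\<not> \<mu> j < b (Suc k)"
        using not_less_Least[of j "\<lambda>i. \<mu> i < b (Suc k)"] j by (simp add: i'_def)
      then show ?thesis using that[of j] i' j by simp
    qed
    \<comment> \<open>Since \<open>\<mu> (Suc j)\<close> is below \<open>b (Suc k)\<close> and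
      avoids the interval, it is at most \<open>a (Suc k)\<close>.\<close>
    have "b (Suc k) - a (Suc k) \<le> \<mu> j - \<mu> (Suc j)" using j miss[OF j(3)] by linarith
    also have "\<dots> \<le> gap_sup \<mu> UNIV n" by (rule gap_le_gap_sup_UNIV[OF s j(1)])
    finally have "(b (Suc k) - a (Suc k)) / a k \<le> gap_sup \<mu> UNIV n / \<mu> n"
      using le pos[of n] ab[of "Suc k"] by (intro frac_le) auto
    then have "q k \<le> gap_sup \<mu> UNIV n / \<mu> n"
      unfolding q_def using b_pos[of "Suc k"] by simp
    with k(2) show ?thesis by blast
  qed
  show ?thesis
  proof (rule order_tendstoI)
    fix x :: real assume "x < 1"
    then obtain K where K: "\<And>k. K \<le> k \<Longrightarrow> x < q k"
      using order_tendstoD(1)[OF \<open>q \<longlonglongrightarrow> 1\<close>] unfolding eventually_sequentially by blast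
    \<comment> \<open>Once \<open>\<mu> n < b K\<close>, the index \<open>k\<close> supplied by
      \<open>key\<close> is at least \<open>K\<close>, where \<open>q k\<close> already exceeds
      \<open>x\<close>.\<close>
    show "\<forall>\<^sub>F n in sequentially. x < gap_sup \<mu> UNIV n / \<mu> n"
      using order_tendstoD(2)[OF mu0 b_pos[of K]]
      by eventually_elim (use key K in \<open>meson less_le_trans\<close>)
  next
    fix x :: real assume "1 < x"
    have "gap_sup \<mu> UNIV n / \<mu> n < x" for n
    proof -
      have "gap_sup \<mu> UNIV n / \<mu> n \<le> 1"
        using gap_sup_UNIV_le[OF s] pos by (simp add: divide_le_eq_1)
      with \<open>1 < x\<close> show ?thesis by linarith
    qed
    then show "\<forall>\<^sub>F n in sequentially. gap_sup \<mu> UNIV n / \<mu> n < x" by simp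
  qed
qed

theorem theorem5p3:
  fixes \<mu> :: "nat \<Rightarrow> real"
  assumes "scaling_function \<mu>"
  shows "lower_porosity \<mu> UNIV = 1 \<longleftrightarrow> range \<mu> \<in> SSP"
  using lower_porosity_UNIV_eq_1_iff[OF assms] porous_imp_SSP[OF assms] SSP_imp_porous[OF assms]
  by blast

end
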